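(* Let $\Gamma$ be a countable set, let $M$ be a measurable space, and let $\underline{X}=(X_k)_{k\in\Gamma}$ be a family of random variables with values in $M$. Let $E\subseteq M^\Gamma$ be an event, and suppose that for every finite set $J\subseteq\Gamma$, every finitary observable $\varphi\colon M^J\to\Sigma$, and every $\varepsilon,\delta>0$, the event $E$ has a positional symmetry $\pi\colon\Gamma\to\Gamma$ such that (i) $\varphi(\underline{X}_J)$ and $\varphi(\underline{X}^\pi_J)$ are $\varepsilon$-dependent, and (ii) the distributions of $\underline{X}$ and $\underline{X}^\pi:=(X_{\pi(k)})_{k\in\Gamma}$ are $\delta$-close. Then $\mathbb{P}(\underline{X}\in E)\in\{0,1\}$.
   Context: $M^\Gamma$ carries the product $\sigma$-algebra, and an event $E\subseteq M^\Gamma$ is a measurable subset. A positional symmetry of an event $E\subseteq M^\Gamma$ is a map $\pi\colon\Gamma\to\Gamma$ (not required to be injective or surjective) such that for every $\underline{a}=(a_k)_{k\in\Gamma}\in M^\Gamma$, one has $\underline{a}\in E$ if and only if $\underline{a}^\pi:=(a_{\pi(k)})_{k\in\Gamma}\in E$. For $J\subseteq\Gamma$, write $\underline{X}_J:=(X_k)_{k\in J}$ and $\underline{X}^\pi_J:=(X_{\pi(k)})_{k\in J}$. A finitary observable is a measurable map with a finite range; here $\Sigma$ is taken to be a finite set with the discrete $\sigma$-algebra. Two random variables $X,Y$ (on the same probability space) with values in measurable spaces $\mathcal{X},\mathcal{Y}$ are $\varepsilon$-dependent if $\sup_{A,B}|\mathbb{P}(X\in A\text{ and }Y\in B)-\mathbb{P}(X\in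 A)\mathbb{P}(Y\in B)|<\varepsilon$, the supremum being over all measurable $A\subseteq\mathcal{X}$, $B\subseteq\mathcal{Y}$. Two probability measures $\mu,\nu$ on the same measurable space are $\delta$-close if $\lVert\mu-\nu\rVert_{\mathrm{TV}}<\delta$, where $\lVert\mu-\nu\rVert_{\mathrm{TV}}:=\sup_A|\mu(A)-\nu(A)|$, the supremum being over all measurable sets $A$. *)

theory Defs
  imports "HOL-Probability.Probability"
begin

text \<open>
  The space \<open>M\<^sup>\<Gamma>\<close> is \<^term>\<open>PiM \<Gamma> (\<lambda>_. M)\<close>; only the space and the sigma-algebra of \<open>M\<close>
  matter.  Its points are the functions that map \<open>\<Gamma>\<close> into \<^term>\<open>space M\<close> and are
  \<^const>\<open>undefined\<close> outside \<open>\<Gamma>\<close>, so every family has to be restricted to its index set.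
\<close>

abbreviation power_space :: "'i set \<Rightarrow> 'a measure \<Rightarrow> ('i \<Rightarrow> 'a) measure"
  where "power_space \<Gamma> M \<equiv> PiM \<Gamma> (\<lambda>_. M)"

definition joint :: "'i set \<Rightarrow> ('i \<Rightarrow> 'w \<Rightarrow> 'a) \<Rightarrow> 'w \<Rightarrow> 'i \<Rightarrow> 'a"
  where "joint J X = (\<lambda>\<omega>. \<lambda>k\<in>J. X k \<omega>)"

definition positional_symmetry ::
    "'i set \<Rightarrow> 'a measure \<Rightarrow> ('i \<Rightarrow> 'a) set \<Rightarrow> ('i \<Rightarrow> 'i) \<Rightarrow> bool"
  where "positional_symmetry \<Gamma> M E \<pi> \<longleftrightarrow>
    \<pi> \<in> \<Gamma> \<rightarrow> \<Gamma> \<and>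
    (\<forall>a \<in> space (power_space \<Gamma> M). a \<in> E \<longleftrightarrow> (\<lambda>k\<in>\<Gamma>. a (\<pi> k)) \<in> E)"

text \<open>
  HOL cannot quantify over the type of the values inside a hypothesis; quantifying over finite
  \<open>S :: nat set\<close> covers all finite discrete value spaces up to relabelling.
\<close>

definition finitary_observable :: "'b measure \<Rightarrow> 's set \<Rightarrow> ('b \<Rightarrow> 's) \<Rightarrow> bool"
  where "finitary_observable N S \<phi> \<longleftrightarrow> finite S \<and> \<phi> \<in> measurable N (count_space S)"

text \<open>
  The two suprema below are taken in the reals.  They are meant for probability measures \<open>P\<close>,
  \<open>\<mu>\<close> and \<open>\<nu>\<close>, for which the sets in question are nonempty and bounded by 1.
\<close>

definition eps_dependent ::
    "'w measure \<Rightarrow> 'b measure \<Rightarrow> 'c measure \<Rightarrow> real \<Rightarrow> ('w \<Rightarrow> 'b) \<Rightarrow> ('w \<Rightarrow> 'c) \<Rightarrow> bool"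
  where "eps_dependent P N N' \<epsilon> X Y \<longleftrightarrow>
    (SUP (A, B) \<in> sets N \<times> sets N'.
       \<bar>\<P>(\<omega> in P. X \<omega> \<in> A \<and> Y \<omega> \<in> B) - \<P>(\<omega> in P. X \<omega> \<in> A) * \<P>(\<omega> in P. Y \<omega> \<in> B)\<bar>) < \<epsilon>"

definition tv_dist :: "'b measure \<Rightarrow> 'b measure \<Rightarrow> real"
  where "tv_dist \<mu> \<nu> = (SUP A \<in> sets \<mu>. \<bar>measure \<mu> A - measure \<nu> A\<bar>)"

definition delta_close :: "real \<Rightarrow> 'b measure \<Rightarrow> 'b measure \<Rightarrow> bool"
  where "delta_close \<delta> \<mu> \<nu> \<longleftrightarrow> sets \<mu> = sets \<nu> \<and> tv_dist \<mu> \<nu> < \<delta>"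

end

theory Submission
  imports Defs
begin

text \<open>
  Approximate \<open>E\<close> by a cylinder event \<open>C\<close> over a finite \<open>J\<close>, and take for \<open>\<phi>\<close> the indicator of its
  base.  The symmetry \<open>\<pi>\<close> makes \<open>X \<in> E\<close> and \<open>X\<^sup>\<pi> \<in> E\<close> the same event; it is approximated by
  \<open>X \<in> C\<close>, by the choice of \<open>C\<close>, and by \<open>X\<^sup>\<pi> \<in> C\<close>, because the distributions of \<open>X\<close> and \<open>X\<^sup>\<pi>\<close> are
  close.  Since \<open>X \<in> C\<close> and \<open>X\<^sup>\<pi> \<in> C\<close> are nearly independent, the probability \<open>p\<close> of \<open>X \<in> E\<close>
  satisfies \<open>p = p\<^sup>2\<close>.
\<close>

text \<open>Induction over \<open>sigma_sets\<close>: complementing both sets leaves their symmetric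
  difference unchanged, and a countable union is first cut down to a finite one by continuity from
  below, after which finitely many pieces are approximated separately.\<close>

lemma (in finite_measure) approx_by_algebra:
  assumes "algebra (space M) \<A>" and gen: "sets M = sigma_sets (space M) \<A>"
    and "E \<in> sets M" and "e > 0"
  shows "\<exists>C\<in>\<A>. measure M (sym_diff E C) < e"
proof -
  interpret A: algebra "space M" \<A> by fact
  have sub: "\<A> \<subseteq> sets M" using gen by auto
  have "E \<in> sigma_sets (space M) \<A>" using assms by simp
  then show ?thesis using \<open>e > 0\<close>
  proof (induction arbitrary: e)
    case (Basic a)
    then show ?case by (intro bexI[of _ a]) auto
  next
    case Empty
    then show ?case by (intro bexI[of _ "{}"]) auto
  next
    case (Compl a)
    then obtain C where C: "C \<in> \<A>" "measure M (sym_diff a C) < e" by blast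
    have "a \<in> sets M" "C \<in> sets M"
      using Compl.hyps gen C(1) by auto
    then have "a \<subseteq> space M" "C \<subseteq> space M"
      by (auto dest: sets.sets_into_space)
    then have "sym_diff (space M - a) (space M - C) = sym_diff a C" by auto
    with C show ?case by (intro bexI[of _ "space M - C"]) auto
  next
    case (Union a)
    have a: "a i \<in> sets M" for i using Union.hyps gen by simp
    have "(\<lambda>n. measure M (\<Union>i<n. a i)) \<longlonglongrightarrow> measure M (\<Union>n. \<Union>i<n. a i)"
      using a by (intro finite_Lim_measure_incseq) (auto simp: incseq_def intro: less_le_trans)
    moreover have "(\<Union>n. \<Union>i<n. a i) = (\<Union>i. a i)" by auto
    ultimately have "\<forall>\<^sub>F n in sequentially. measure M (\<Union>i. a i) - e/2 < measure M (\<Union>i<n. a i)"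
      using Union.prems by (intro order_tendstoD) auto
    then obtain n where n: "measure M (\<Union>i. a i) - e/2 < measure M (\<Union>i<n. a i)"
      by (auto simp: eventually_sequentially)
    \<comment> \<open>The \<open>n\<close> pieces share an error of \<open>e / 2\<close>;
      \<open>Suc n\<close> keeps the denominator positive when \<open>n = 0\<close>.\<close>
    have "e / (2 * real (Suc n)) > 0" using Union.prems by simp
    then have "\<forall>i. \<exists>C\<in>\<A>. measure M (sym_diff (a i) C) < e / (2 * real (Suc n))"
      using Union.IH by blast
    then obtain C where C: "\<And>i. C i \<in> \<A>"
      "\<And>i. measure M (sym_diff (a i) (C i)) < e / (2 * real (Suc n))" by metis
    have Cs: "C i \<in> sets M" for i using C sub by auto
    have "measure M (\<Union>i<n. sym_diff (a i) (C i)) \<le> (\<Sum>i<n. measure M (sym_diff (a i) (C i)))"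
      using a Cs by (intro finite_measure_subadditive_finite) auto
    also have "\<dots> \<le> (\<Sum>i<n. e / (2 * real (Suc n)))"
      by (intro sum_mono less_imp_le C)
    also have "\<dots> = (e / 2) * (n / Suc n)" by simp
    also have "\<dots> \<le> e / 2" using Union.prems by (intro mult_left_le) auto
    finally have fin: "measure M (\<Union>i<n. sym_diff (a i) (C i)) \<le> e / 2" .
    have tail: "measure M ((\<Union>i. a i) - (\<Union>i<n. a i)) < e / 2"
      using n a by (subst finite_measure_Diff) (auto intro!: sets.countable_UN)
    \<comment> \<open>A point on which the two unions disagree lies either in the tail that was cut
      off or in one of the first \<open>n\<close> symmetric differences.\<close>
    have "measure M (sym_diff (\<Union>i. a i) (\<Union>i<n. C i))
        \<le> measure M (((\<Union>i. a i) - (\<Union>i<n. a i)) \<union> (\<Union>i<n. sym_diff (a i) (C i)))"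
      using a Cs by (intro finite_measure_mono) (auto intro!: sets.Un sets.Diff sets.countable_UN sets.finite_UN)
    also have "\<dots> \<le> measure M ((\<Union>i. a i) - (\<Union>i<n. a i)) + measure M (\<Union>i<n. sym_diff (a i) (C i))"
      using a Cs by (intro measure_Un_le) (auto intro!: sets.Un sets.Diff sets.countable_UN sets.finite_UN)
    also have "\<dots> < e" using fin tail by simp
    finally show ?case using C by (intro bexI[of _ "\<Union>i<n. C i"]) auto
  qed
qed

text \<open>The cylinders over finite index sets form an algebra that generates the product
  \<sigma>-algebra, so \<open>approx_by_algebra\<close> applies to them.\<close>

lemma approx_by_cylinder:
  fixes \<mu> :: "('i \<Rightarrow> 'a) measure"
  assumes "prob_space \<mu>" and sets: "sets \<mu> = sets (PiM I M)" and E: "E \<in> sets \<mu>" and "e > 0"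
  obtains J D where "finite J" "J \<subseteq> I" "D \<in> sets (PiM J M)"
    "measure \<mu> (sym_diff E (prod_emb I M J D)) < e"
proof -
  interpret prob_space \<mu> by fact
  have restr: "(\<lambda>f. restrict f J) \<in> measurable \<mu> (PiM J M)" if "J \<subseteq> I" for J
    using that by (subst measurable_cong_sets[OF sets refl]) (rule measurable_restrict_subset)
  have sp: "space \<mu> = space (PiM I M)" using sets by (rule sets_eq_imp_space_eq)
  \<comment> \<open>Only for its cylinder algebra, which the library calls \<open>generator\<close>.\<close>
  interpret projective_family I "\<lambda>J. distr \<mu> (PiM J M) (\<lambda>f. restrict f J)" M
  proof (rule projective_family.intro)
    fix J H assume JH: "J \<subseteq> H" "finite H" "H \<subseteq> I"
    then have "distr (distr \<mu> (PiM H M) (\<lambda>f. restrict f H)) (PiM J M) (\<lambda>f. restrict f J)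
        = distr \<mu> (PiM J M) ((\<lambda>f. restrict f J) \<circ> (\<lambda>f. restrict f H))"
      by (intro distr_distr restr measurable_restrict_subset)
    also have "(\<lambda>f. restrict f J) \<circ> (\<lambda>f. restrict f H) = (\<lambda>f :: 'i \<Rightarrow> 'a. restrict f J)"
      using JH by (auto simp: fun_eq_iff restrict_def)
    finally show "distr \<mu> (PiM J M) (\<lambda>f. restrict f J)
        = distr (distr \<mu> (PiM H M) (\<lambda>f. restrict f H)) (PiM J M) (\<lambda>f. restrict f J)" by (rule sym)
  next
    fix J assume "finite J" "J \<subseteq> I"
    then show "prob_space (distr \<mu> (PiM J M) (\<lambda>f. restrict f J))"
      by (intro prob_space_distr restr)
  qed
  have "\<exists>C\<in>generator. measure \<mu> (sym_diff E C) < e"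
    using algebra_generator sets_PiM_generator E \<open>e > 0\<close>
    by (intro approx_by_algebra) (simp_all add: sp sets)
  then show thesis by (auto elim!: generator.cases intro: that)
qed

lemma measurable_joint:
  assumes "\<And>k. k \<in> J \<Longrightarrow> X k \<in> measurable P M"
  shows "joint J X \<in> measurable P (power_space J M)"
  unfolding joint_def using assms by (rule measurable_restrict)

lemma joint_in_prod_emb_iff:
  assumes "J \<subseteq> I" and "\<And>k. k \<in> I \<Longrightarrow> X k \<in> measurable P M" and "\<omega> \<in> space P"
  shows "joint I X \<omega> \<in> prod_emb I (\<lambda>_. M) J D \<longleftrightarrow> joint J X \<omega> \<in> D"
proof -
  have "restrict (joint I X \<omega>) J = joint J X \<omega>"
    using assms(1) by (auto simp: joint_def restrict_def fun_eq_iff)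
  moreover have "joint I X \<omega> \<in> (\<Pi>\<^sub>E i\<in>I. space M)"
    using assms by (auto simp: joint_def dest: measurable_space)
  ultimately show ?thesis by (auto simp: prod_emb_def)
qed

text \<open>The defining equivalence of a symmetry, taken at the point
  \<open>joint \<Gamma> X \<omega>\<close>. Since \<open>\<pi>\<close> maps \<open>\<Gamma>\<close>
  into itself, permuting the restricted family never reads an \<open>undefined\<close>
  coordinate.\<close>

lemma positional_symmetry_joint_iff:
  assumes "positional_symmetry \<Gamma> M E \<pi>" and "\<And>k. k \<in> \<Gamma> \<Longrightarrow> X k \<in> measurable P M"
    and "\<omega> \<in> space P"
  shows "joint \<Gamma> (\<lambda>k. X (\<pi> k)) \<omega> \<in> E \<longleftrightarrow> joint \<Gamma> X \<omega> \<in> E"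
proof -
  have "joint \<Gamma> X \<omega> \<in> space (power_space \<Gamma> M)"
    using measurable_joint[of \<Gamma> X P M] assms by (auto dest: measurable_space)
  then have "joint \<Gamma> X \<omega> \<in> E \<longleftrightarrow> (\<lambda>k\<in>\<Gamma>. joint \<Gamma> X \<omega> (\<pi> k)) \<in> E"
    using assms(1) by (auto simp: positional_symmetry_def)
  also have "(\<lambda>k\<in>\<Gamma>. joint \<Gamma> X \<omega> (\<pi> k)) = joint \<Gamma> (\<lambda>k. X (\<pi> k)) \<omega>"
    using assms(1) by (auto simp: positional_symmetry_def joint_def restrict_def fun_eq_iff)
  finally show ?thesis by simp
qed

text \<open>A real supremum dominates its members only if they are bounded above; here 1 is a bound,
  both measures being probabilities.\<close>

lemma delta_closeD:
  assumes "prob_space \<mu>" "prob_space \<nu>" "delta_close \<delta> \<mu> \<nu>" "A \<in> sets \<mu>"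
  shows "\<bar>measure \<mu> A - measure \<nu> A\<bar> < \<delta>"
proof -
  interpret \<mu>: prob_space \<mu> by fact
  interpret \<nu>: prob_space \<nu> by fact
  have "bdd_above ((\<lambda>A. \<bar>measure \<mu> A - measure \<nu> A\<bar>) ` sets \<mu>)"
  proof (intro bdd_aboveI2)
    fix A show "\<bar>measure \<mu> A - measure \<nu> A\<bar> \<le> 1"
      using \<mu>.prob_le_1[of A] \<nu>.prob_le_1[of A] measure_nonneg[of \<mu> A] measure_nonneg[of \<nu> A]
      by linarith
  qed
  then have "\<bar>measure \<mu> A - measure \<nu> A\<bar> \<le> tv_dist \<mu> \<nu>"
    unfolding tv_dist_def using assms(4) by (intro cSUP_upper)
  with assms(3) show ?thesis by (simp add: delta_close_def)
qed

text \<open>Boundedness of the supremum comes from the finiteness of \<open>S\<close>: there are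
  only finitely many pairs of subsets.\<close>

lemma eps_dependent_finiteD:
  assumes "finite S" "eps_dependent P (count_space S) (count_space S) \<epsilon> X Y" "A \<subseteq> S" "B \<subseteq> S"
  shows "\<bar>\<P>(\<omega> in P. X \<omega> \<in> A \<and> Y \<omega> \<in> B) - \<P>(\<omega> in P. X \<omega> \<in> A) * \<P>(\<omega> in P. Y \<omega> \<in> B)\<bar> < \<epsilon>"
proof -
  let ?f = "\<lambda>(A, B).
    \<bar>\<P>(\<omega> in P. X \<omega> \<in> A \<and> Y \<omega> \<in> B) - \<P>(\<omega> in P. X \<omega> \<in> A) * \<P>(\<omega> in P. Y \<omega> \<in> B)\<bar>"
  have "bdd_above (?f ` (Pow S \<times> Pow S))" using assms(1) by (intro bdd_above_finite) auto
  then have "?f (A, B) \<le> (SUP x \<in> Pow S \<times> Pow S. ?f x)"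
    using assms(3,4) by (intro cSUP_upper) auto
  with assms(2) show ?thesis by (simp add: eps_dependent_def)
qed

lemma (in finite_measure) abs_measure_diff_le:
  assumes "A \<in> sets M" "B \<in> sets M"
  shows "\<bar>measure M A - measure M B\<bar> \<le> measure M (sym_diff A B)"
proof -
  have "measure M A \<le> measure M (B \<union> sym_diff A B)" "measure M B \<le> measure M (A \<union> sym_diff A B)"
    using assms by (auto intro!: finite_measure_mono)
  moreover have "measure M (B \<union> sym_diff A B) \<le> measure M B + measure M (sym_diff A B)"
    "measure M (A \<union> sym_diff A B) \<le> measure M A + measure M (sym_diff A B)"
    using assms by (auto intro!: measure_Un_le)
  ultimately show ?thesis by linarith
qed

text \<open>The constant is 3 + 1 + 3: from \<open>prob A\<close> to
  \<open>prob (B \<inter> C)\<close>, then to \<open>prob B * prob C\<close> by near independence,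
  then to \<open>prob A * prob A\<close>.\<close>

lemma (in prob_space) near_idempotent_of_approx:
  assumes [measurable]: "A \<in> sets M" "B \<in> sets M" "C \<in> sets M"
    and "prob (sym_diff A B) < \<eta>" "prob (sym_diff A C) < 2 * \<eta>"
    and "\<bar>prob (B \<inter> C) - prob B * prob C\<bar> < \<eta>"
  shows "\<bar>prob A - prob A * prob A\<bar> < 7 * \<eta>"
proof -
  have "prob (sym_diff A (B \<inter> C)) \<le> prob (sym_diff A B \<union> sym_diff A C)"
    by (intro finite_measure_mono) auto
  also have "\<dots> \<le> prob (sym_diff A B) + prob (sym_diff A C)"
    by (intro measure_Un_le) auto
  finally have "\<bar>prob A - prob (B \<inter> C)\<bar> < 3 * \<eta>"
    using abs_measure_diff_le[of A "B \<inter> C"] assms by simp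
  moreover have "\<bar>prob A * prob A - prob B * prob C\<bar> \<le> \<bar>prob A - prob B\<bar> + \<bar>prob A - prob C\<bar>"
  proof -
    \<comment> \<open>Changing one factor at a time leaves coefficients that are probabilities,
      hence at most 1.\<close>
    have "prob A * prob A - prob B * prob C = prob A * (prob A - prob C) + prob C * (prob A - prob B)"
      by (simp add: algebra_simps)
    then have "\<bar>prob A * prob A - prob B * prob C\<bar>
        \<le> prob A * \<bar>prob A - prob C\<bar> + prob C * \<bar>prob A - prob B\<bar>"
      using abs_triangle_ineq[of "prob A * (prob A - prob C)" "prob C * (prob A - prob B)"]
      by (simp add: abs_mult)
    also have "\<dots> \<le> \<bar>prob A - prob C\<bar> + \<bar>prob A - prob B\<bar>"
      by (intro add_mono mult_left_le_one_le) auto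
    finally show ?thesis by simp
  qed
  moreover have "\<bar>prob A - prob B\<bar> < \<eta>" "\<bar>prob A - prob C\<bar> < 2 * \<eta>"
    using abs_measure_diff_le[of A B] abs_measure_diff_le[of A C] assms by auto
  ultimately show ?thesis using assms by linarith
qed

theorem theorem4:
  fixes P :: "'w measure" and M :: "'a measure" and \<Gamma> :: "'i set"
    and X :: "'i \<Rightarrow> 'w \<Rightarrow> 'a" and E :: "('i \<Rightarrow> 'a) set"
  assumes "prob_space P"
    and "countable \<Gamma>"
    and "\<And>k. k \<in> \<Gamma> \<Longrightarrow> X k \<in> measurable P M"
    and "E \<in> sets (power_space \<Gamma> M)"
    and "\<And>(J :: 'i set) (S :: nat set) (\<phi> :: ('i \<Rightarrow> 'a) \<Rightarrow> nat) (\<epsilon> :: real) (\<delta> :: real).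
           finite J \<Longrightarrow> J \<subseteq> \<Gamma> \<Longrightarrow> finitary_observable (power_space J M) S \<phi> \<Longrightarrow>
           \<epsilon> > 0 \<Longrightarrow> \<delta> > 0 \<Longrightarrow>
           \<exists>\<pi>. positional_symmetry \<Gamma> M E \<pi> \<and>
               eps_dependent P (count_space S) (count_space S) \<epsilon>
                 (\<lambda>\<omega>. \<phi> (joint J X \<omega>)) (\<lambda>\<omega>. \<phi> (joint J (\<lambda>k. X (\<pi> k)) \<omega>)) \<and>
               delta_close \<delta> (distr P (power_space \<Gamma> M) (joint \<Gamma> X))
                 (distr P (power_space \<Gamma> M) (joint \<Gamma> (\<lambda>k. X (\<pi> k))))"
  shows "\<P>(\<omega> in P. joint \<Gamma> X \<omega> \<in> E) \<in> {0, 1}"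
proof -
  interpret prob_space P by fact
  note X = assms(3) and E = assms(4)
  let ?p = "\<P>(\<omega> in P. joint \<Gamma> X \<omega> \<in> E)"
  have mX [measurable]: "joint \<Gamma> X \<in> measurable P (power_space \<Gamma> M)"
    using X by (rule measurable_joint)
  let ?\<mu> = "distr P (power_space \<Gamma> M) (joint \<Gamma> X)"
  have \<mu>: "prob_space ?\<mu>" by (rule prob_space_distr) (rule mX)
  have small: "\<bar>?p - ?p * ?p\<bar> < 7 * \<eta>" if "\<eta> > 0" for \<eta> :: real
  proof -
    obtain J D where J: "finite J" "J \<subseteq> \<Gamma>" and D: "D \<in> sets (power_space J M)"
      and approx: "measure ?\<mu> (sym_diff E (prod_emb \<Gamma> (\<lambda>_. M) J D)) < \<eta>"
      using approx_by_cylinder[OF \<mu>, of \<Gamma> "\<lambda>_. M" E \<eta>] E \<open>\<eta> > 0\<close> by auto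
    define C where "C = prod_emb \<Gamma> (\<lambda>_. M) J D"
    have C: "C \<in> sets (power_space \<Gamma> M)" unfolding C_def using J D by (intro measurable_prod_emb)
    \<comment> \<open>The values are natural numbers because the hypothesis speaks of observables of
      that type.\<close>
    define \<phi> :: "('i \<Rightarrow> 'a) \<Rightarrow> nat" where "\<phi> = (\<lambda>x. if x \<in> D then 1 else 0)"
    have "finitary_observable (power_space J M) {0, 1} \<phi>"
      unfolding finitary_observable_def \<phi>_def using D by (auto intro!: measurable_If_set)
    from assms(5)[OF J this \<open>\<eta> > 0\<close> \<open>\<eta> > 0\<close>] obtain \<pi>
      where \<pi>: "positional_symmetry \<Gamma> M E \<pi>"
        and dep: "eps_dependent P (count_space {0, 1}) (count_space {0, 1}) \<eta>
             (\<lambda>\<omega>. \<phi> (joint J X \<omega>)) (\<lambda>\<omega>. \<phi> (joint J (\<lambda>k. X (\<pi> k)) \<omega>))"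
        and close: "delta_close \<eta> ?\<mu> (distr P (power_space \<Gamma> M) (joint \<Gamma> (\<lambda>k. X (\<pi> k))))"
      by blast
    let ?Y = "\<lambda>k. X (\<pi> k)"
    let ?\<nu> = "distr P (power_space \<Gamma> M) (joint \<Gamma> ?Y)"
    have Y: "?Y k \<in> measurable P M" if "k \<in> \<Gamma>" for k
      using \<pi> that X by (auto simp: positional_symmetry_def)
    have mY [measurable]: "joint \<Gamma> ?Y \<in> measurable P (power_space \<Gamma> M)"
      using Y by (rule measurable_joint)
    have \<nu>: "prob_space ?\<nu>" by (rule prob_space_distr) (rule mY)
    let ?A = "{\<omega> \<in> space P. joint \<Gamma> X \<omega> \<in> E}"
    let ?B = "{\<omega> \<in> space P. joint \<Gamma> X \<omega> \<in> C}" and ?C = "{\<omega> \<in> space P. joint \<Gamma> ?Y \<omega> \<in> C}"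
    have sd: "sym_diff E C \<in> sets (power_space \<Gamma> M)" using E C by auto
    have "joint \<Gamma> X -` sym_diff E C \<inter> space P = sym_diff ?A ?B" by auto
    then have AB: "prob (sym_diff ?A ?B) = measure ?\<mu> (sym_diff E C)"
      using measure_distr[OF mX sd] by simp
    \<comment> \<open>By the symmetry, pulling \<open>E\<close> back along the permuted family gives
      \<open>?A\<close> again, so \<open>?C\<close> is compared with the same event as
      \<open>?B\<close> is.\<close>
    have "joint \<Gamma> ?Y -` sym_diff E C \<inter> space P = sym_diff ?A ?C"
      using positional_symmetry_joint_iff[where X = X, OF \<pi> X] by auto
    then have AC: "prob (sym_diff ?A ?C) = measure ?\<nu> (sym_diff E C)"
      using measure_distr[OF mY sd] by simp
    \<comment> \<open>Closeness is applied to the single event \<open>sym_diff E C\<close>: the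
      approximation error grows from \<eta> to at most 2 \<eta> on passing to the permuted
      family.\<close>
    have "\<bar>measure ?\<mu> (sym_diff E C) - measure ?\<nu> (sym_diff E C)\<bar> < \<eta>"
      using sd by (intro delta_closeD[OF \<mu> \<nu> close]) simp
    then have "prob (sym_diff ?A ?B) < \<eta>" "prob (sym_diff ?A ?C) < 2 * \<eta>"
      using approx AB AC by (auto simp: C_def)
    moreover have "\<bar>prob (?B \<inter> ?C) - prob ?B * prob ?C\<bar> < \<eta>"
    proof -
      \<comment> \<open>Membership in the cylinder is decided by the coordinates in
        \<open>J\<close>, so \<open>?B\<close> and \<open>?C\<close> are the events that \<phi>
        takes the value 1 on the two families.\<close>
      have "{\<omega> \<in> space P. \<phi> (joint J X \<omega>) \<in> {1}} = ?B"
        "{\<omega> \<in> space P. \<phi> (joint J ?Y \<omega>) \<in> {1}} = ?C"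
        "{\<omega> \<in> space P. \<phi> (joint J X \<omega>) \<in> {1} \<and> \<phi> (joint J ?Y \<omega>) \<in> {1}} = ?B \<inter> ?C"
        using joint_in_prod_emb_iff[where X = X, OF J(2) X] joint_in_prod_emb_iff[where X = ?Y, OF J(2) Y]
        by (auto simp: \<phi>_def C_def)
      then show ?thesis using eps_dependent_finiteD[OF _ dep, of "{1}" "{1}"] by simp
    qed
    moreover have "?A \<in> events" "?B \<in> events" "?C \<in> events"
      using measurable_sets[OF mX E] measurable_sets[OF mX C] measurable_sets[OF mY C]
      by (simp_all add: vimage_def Int_def conj_commute)
    ultimately show ?thesis by (intro near_idempotent_of_approx)
  qed
  \<comment> \<open>The probability \<open>?p\<close> does not depend on \<eta>, so \<eta> can be
    \<open>e / 7\<close> for every positive \<open>e\<close>.\<close>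
  have "\<bar>?p - ?p * ?p\<bar> \<le> 0"
    by (rule field_le_epsilon) (use small[of "e / 7" for e] in force)
  then have "?p * (1 - ?p) = 0" by (simp add: algebra_simps)
  then show ?thesis by simp
qed

end
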